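(* Let $k\ge 0$ be an integer and let $\varepsilon(x,\xi)\ge 0$, $\rho(x,\xi)$, $f(x,\xi)$ be elements of $C^{k+1}(\mathbb{S}D)$. Put $\alpha=\varepsilon+\mathrm{i}\rho$ and let $u_k$ be the attenuated ray transform of order $k$ of $f$. Then $u_k$ is a solution of the equation $$(\mathcal{L}_{k+1}u_k)(x,\xi)=f(x,\xi),\qquad (x,\xi)\in \mathbb{S}D .$$ In particular, if $m\ge 0$ is an integer, $w$ is a symmetric $m$-tensor field on $D$ of class $C^{k+1}$ and $f(x,\xi)=\langle w(x),\xi^m\rangle$, then $$(\mathcal{L}_{k+1}u_k)(x,\xi)=\langle w(x),\xi^m\rangle ,\qquad (x,\xi)\in \mathbb{S}D .$$
   Context: $D\subset\mathbb{R}^3$ is a bounded convex domain with smooth boundary, $\mathbb{S}^2$ is the unit sphere of $\mathbb{R}^3$, and $\mathbb{S}D=\{(x,\xi): x\in D,\ \xi\in\mathbb{S}^2\}$. The functions $\varepsilon,\rho$ are real-valued. The functions $\varepsilon,\rho,f$ (and the field $w$) are bounded and finite with respect to $x$, i.e. they vanish for $x$ outside some compact subset of $D$; they are extended by zero to all $x\in\mathbb{R}^3$. The attenuated ray transform (ART) of order $k$ of $f$ is $$u_k(x,\xi)=\int_0^\infty s^k\exp\Big(-\int_0^s\alpha(x-\sigma\xi,\xi)\,d\sigma\Big) f(x-s\xi,\xi)\,ds .$$ The operator $\mathcal{H}$ is $(\mathcal{H}\psi)(x,\xi)=\frac{d}{d\tau}\psi(x+\tau\xi,\xi)\big|_{\tau=0}=\sum_{j=1}^3\xi^j\frac{\partial\psi}{\partial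 x^j}(x,\xi)$. The operators $\mathcal{L}_k$ are defined by $\mathcal{L}_1\psi=(\mathcal{H}+\alpha)\psi$ and $\mathcal{L}_k\psi=\frac{1}{k-1}(\mathcal{H}+\alpha)\mathcal{L}_{k-1}\psi$ for integers $k>1$, where $\alpha$ acts by multiplication. A symmetric $m$-tensor field $w$ has components $w_{i_1\ldots i_m}(x)$, $i_1,\dots,i_m\in\{1,2,3\}$, symmetric in the indices, and $\langle w(x),\xi^m\rangle=\sum_{i_1,\dots,i_m=1}^3 w_{i_1\ldots i_m}(x)\xi^{i_1}\cdots\xi^{i_m}$. *)

theory Defs
  imports "HOL-Analysis.Analysis"
begin

type_synonym phase = "(real^3) \<times> (real^3)"

text \<open>Class \<open>C\<^sup>n\<close> on an open set, by recursion on directional derivatives.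
  Only meaningful for open \<open>U\<close>.\<close>

fun Ck_on_open :: "nat \<Rightarrow> ('a::euclidean_space \<Rightarrow> 'b::real_normed_vector) \<Rightarrow> 'a set \<Rightarrow> bool" where
  "Ck_on_open 0 f U \<longleftrightarrow> continuous_on U f"
| "Ck_on_open (Suc n) f U \<longleftrightarrow> (\<forall>x\<in>U. f differentiable (at x)) \<and>
     (\<forall>v. Ck_on_open n (\<lambda>x. frechet_derivative f (at x) v) U)"

text \<open>Class \<open>C\<^sup>n\<close> on an embedded submanifold \<open>S\<close> such as \<open>D \<times> S\<^sup>2\<close>:
  near each point of \<open>S\<close> the function is the restriction of a \<open>C\<^sup>n\<close> function of the ambient space.\<close>

definition Ck_on_submanifold ::
    "nat \<Rightarrow> ('a::euclidean_space \<Rightarrow> 'b::real_normed_vector) \<Rightarrow> 'a set \<Rightarrow> bool" where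
  "Ck_on_submanifold n f S \<longleftrightarrow>
     (\<forall>p\<in>S. \<exists>U g. open U \<and> p \<in> U \<and> Ck_on_open n g U \<and> (\<forall>q\<in>S \<inter> U. f q = g q))"

text \<open>Smooth boundary: near each boundary point \<open>D\<close> is the negative side of a smooth function
  without critical points.\<close>

definition smooth_boundary :: "('a::euclidean_space) set \<Rightarrow> bool" where
  "smooth_boundary D \<longleftrightarrow>
     (\<forall>p\<in>frontier D. \<exists>U (\<phi> :: 'a \<Rightarrow> real). open U \<and> p \<in> U \<and> (\<forall>n. Ck_on_open n \<phi> U) \<and>
        (\<forall>x\<in>U. \<exists>v. frechet_derivative \<phi> (at x) v \<noteq> 0) \<and> D \<inter> U = {x\<in>U. \<phi> x < 0})"

definition bounded_convex_smooth_domain :: "('a::euclidean_space) set \<Rightarrow> bool" where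
  "bounded_convex_smooth_domain D \<longleftrightarrow>
     open D \<and> D \<noteq> {} \<and> bounded D \<and> convex D \<and> smooth_boundary D"

definition sphere_bundle :: "(real^3) set \<Rightarrow> phase set" where
  "sphere_bundle D = D \<times> sphere 0 1"

text \<open>Functions on \<open>sphere_bundle D\<close> are represented by total functions. The vanishing condition
  ranges over all \<open>x\<close> outside \<open>K\<close>, including \<open>x \<notin> D\<close>, so it also expresses the extension by zero.\<close>

definition finite_in_x :: "(real^3) set \<Rightarrow> (phase \<Rightarrow> 'b::zero) \<Rightarrow> bool" where
  "finite_in_x D f \<longleftrightarrow>
     (\<exists>K. compact K \<and> K \<subseteq> D \<and> (\<forall>x \<xi>. x \<notin> K \<longrightarrow> \<xi> \<in> sphere 0 1 \<longrightarrow> f (x, \<xi>) = 0))"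

definition admissible_function ::
    "nat \<Rightarrow> (real^3) set \<Rightarrow> (phase \<Rightarrow> 'b::real_normed_vector) \<Rightarrow> bool" where
  "admissible_function n D f \<longleftrightarrow> Ck_on_submanifold n f (sphere_bundle D) \<and>
     bounded (f ` sphere_bundle D) \<and> finite_in_x D f"

definition ART :: "(phase \<Rightarrow> complex) \<Rightarrow> nat \<Rightarrow> (phase \<Rightarrow> complex) \<Rightarrow> phase \<Rightarrow> complex" where
  "ART \<alpha> k f = (\<lambda>(x, \<xi>).
     integral {0..} (\<lambda>s::real. of_real (s ^ k) *
       exp (- integral {0..s} (\<lambda>\<sigma>. \<alpha> (x - \<sigma> *\<^sub>R \<xi>, \<xi>))) * f (x - s *\<^sub>R \<xi>, \<xi>)))"

definition H_op :: "(phase \<Rightarrow> complex) \<Rightarrow> phase \<Rightarrow> complex" where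
  "H_op \<psi> = (\<lambda>(x, \<xi>). vector_derivative (\<lambda>\<tau>::real. \<psi> (x + \<tau> *\<^sub>R \<xi>, \<xi>)) (at 0))"

lemma H_op_eq_sum_partials:
  assumes "(\<lambda>y. \<psi> (y, \<xi>)) differentiable (at x)"
  shows "H_op \<psi> (x, \<xi>) =
    (\<Sum>j\<in>UNIV. of_real (\<xi> $ j) * vector_derivative (\<lambda>t::real. \<psi> (x + t *\<^sub>R axis j 1, \<xi>)) (at 0))"
proof -
  obtain F where F: "((\<lambda>y. \<psi> (y, \<xi>)) has_derivative F) (at x)"
    using assms by (auto simp: differentiable_def)
  have lin: "linear F"
    using F by (rule has_derivative_linear)
  have dir: "vector_derivative (\<lambda>t::real. \<psi> (x + t *\<^sub>R v, \<xi>)) (at 0) = F v" for v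
  proof (rule vector_derivative_at)
    have line: "((\<lambda>t::real. x + t *\<^sub>R v) has_derivative (\<lambda>t. t *\<^sub>R v)) (at 0)"
      by (auto intro!: derivative_eq_intros)
    have "((\<lambda>t::real. \<psi> (x + t *\<^sub>R v, \<xi>)) has_derivative (\<lambda>t. F (t *\<^sub>R v))) (at 0)"
      using has_derivative_compose[OF line, of "\<lambda>y. \<psi> (y, \<xi>)" F] F by simp
    then show "((\<lambda>t::real. \<psi> (x + t *\<^sub>R v, \<xi>)) has_vector_derivative F v) (at 0)"
      by (simp add: has_vector_derivative_def linear_cmul[OF lin])
  qed
  have "F \<xi> = F (\<Sum>j\<in>UNIV. (\<xi> $ j) *\<^sub>R axis j 1)"
    using basis_expansion[of \<xi>] by (simp add: scalar_mult_eq_scaleR)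
  also have "\<dots> = (\<Sum>j\<in>UNIV. of_real (\<xi> $ j) * F (axis j 1))"
    unfolding linear_sum[OF lin] linear_cmul[OF lin] by (rule sum.cong) (simp_all only: scaleR_conv_of_real)
  finally show ?thesis
    by (simp add: H_op_def dir)
qed

text \<open>\<open>L_op \<alpha> k\<close> is \<open>\<L>\<^sub>k\<close> for \<open>k \<ge> 1\<close>; by convention \<open>L_op \<alpha> 0\<close> is the identity.\<close>

fun L_op :: "(phase \<Rightarrow> complex) \<Rightarrow> nat \<Rightarrow> (phase \<Rightarrow> complex) \<Rightarrow> phase \<Rightarrow> complex" where
  "L_op \<alpha> 0 \<psi> = \<psi>"
| "L_op \<alpha> (Suc 0) \<psi> = (\<lambda>p. H_op \<psi> p + \<alpha> p * \<psi> p)"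
| "L_op \<alpha> (Suc (Suc j)) \<psi> = (\<lambda>p. 1 / of_nat (Suc j) *
     (H_op (L_op \<alpha> (Suc j) \<psi>) p + \<alpha> p * L_op \<alpha> (Suc j) \<psi> p))"

text \<open>Since \<open>vector_derivative\<close> is total, the first conjunct is needed to guarantee that every
  derivative taken in forming \<open>\<L>\<^sub>n u\<close> on \<open>sphere_bundle D\<close> exists; by
  \<open>H_op_eq_sum_partials\<close> both usual expressions for \<open>H_op\<close> then agree.\<close>

definition solves_L_equation ::
    "(real^3) set \<Rightarrow> (phase \<Rightarrow> complex) \<Rightarrow> nat \<Rightarrow> (phase \<Rightarrow> complex) \<Rightarrow> (phase \<Rightarrow> complex) \<Rightarrow> bool" where
  "solves_L_equation D \<alpha> n u f \<longleftrightarrow>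
     (\<forall>j<n. \<forall>(x, \<xi>)\<in>sphere_bundle D. (\<lambda>y. L_op \<alpha> j u (y, \<xi>)) differentiable (at x)) \<and>
     (\<forall>(x, \<xi>)\<in>sphere_bundle D. L_op \<alpha> n u (x, \<xi>) = f (x, \<xi>))"

text \<open>The component with indices \<open>i\<^sub>1 \<dots> i\<^sub>m\<close> of an \<open>m\<close>-tensor field \<open>w\<close> at \<open>x\<close> is
  \<open>w x [i\<^sub>1, \<dots>, i\<^sub>m]\<close>; values at lists of other lengths are irrelevant. The three elements
  of the type \<open>3\<close> are the coordinate indices.\<close>

type_synonym tensor_field = "real^3 \<Rightarrow> 3 list \<Rightarrow> complex"

definition symmetric_tensor_field :: "nat \<Rightarrow> tensor_field \<Rightarrow> bool" where
  "symmetric_tensor_field m w \<longleftrightarrow>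
     (\<forall>x is js. length is = m \<longrightarrow> mset is = mset js \<longrightarrow> w x is = w x js)"

definition admissible_tensor_field ::
    "nat \<Rightarrow> nat \<Rightarrow> (real^3) set \<Rightarrow> tensor_field \<Rightarrow> bool" where
  "admissible_tensor_field n m D w \<longleftrightarrow> symmetric_tensor_field m w \<and>
     (\<forall>is. length is = m \<longrightarrow> Ck_on_open n (\<lambda>x. w x is) D \<and> bounded ((\<lambda>x. w x is) ` D)) \<and>
     (\<exists>K. compact K \<and> K \<subseteq> D \<and> (\<forall>x is. x \<notin> K \<longrightarrow> length is = m \<longrightarrow> w x is = 0))"

definition tensor_pairing :: "nat \<Rightarrow> (3 list \<Rightarrow> complex) \<Rightarrow> real^3 \<Rightarrow> complex" where
  "tensor_pairing m T \<xi> =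
     (\<Sum>is | length is = m. T is * of_real (\<Prod>l<m. \<xi> $ (is ! l)))"

end

theory Submission
  imports Defs
begin

text \<open>The direction \<open>\<xi>\<close> is a mere parameter: \<open>\<H>\<close> differentiates only in \<open>x\<close>, and \<open>u\<^sub>k(x, \<xi>)\<close>
  involves \<open>\<alpha>\<close> and \<open>f\<close> only at the same \<open>\<xi>\<close>. For a fixed unit vector \<open>\<xi>\<close>, the slices \<open>\<alpha>(\<cdot>, \<xi>)\<close> and
  \<open>f(\<cdot>, \<xi>)\<close>, extended by zero, are functions of class \<open>C\<^sup>1\<close> on the whole space with bounded support
  (\<open>C1_slice_of_admissible_function\<close>, \<open>C1_tensor_pairing\<close>), so boundary effects do not arise.

  The heart of the matter is the recursion
  \<open>(\<H> + \<alpha>) u\<^sub>n = n u\<^sub>n\<^sub>-\<^sub>1\<close> for \<open>n \<ge> 1\<close> and \<open>(\<H> + \<alpha>) u\<^sub>0 = f\<close>,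
  proved in \<open>ray_moment_transport\<close> and restated in \<open>ART_transport\<close>. Write \<open>g(s)\<close> for the
  exponential weight times \<open>f(x - s\<xi>, \<xi>)\<close>, so that \<open>u\<^sub>n(x, \<xi>)\<close> is the integral of \<open>s\<^sup>n g(s)\<close>.
  Moving \<open>x\<close> along \<open>\<xi>\<close> is, up to a multiplication by \<open>\<alpha>(x, \<xi>)\<close>, the same as shifting \<open>s\<close>: the
  derivative of the integrand along \<open>\<xi>\<close> is \<open>s\<^sup>n (- \<alpha>(x, \<xi>) g(s) - g'(s))\<close>. Integrating the last
  term by parts gives \<open>n u\<^sub>n\<^sub>-\<^sub>1\<close>, and for \<open>n = 0\<close> the boundary term \<open>g(0) = f(x, \<xi>)\<close>.

  Iterating the recursion with the factors \<open>1 / (j - 1)\<close> from the definition of \<open>\<L>\<^sub>j\<close> produces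
  binomial coefficients: \<open>\<L>\<^sub>j\<^sub>+\<^sub>1 u\<^sub>k\<close> is \<open>k choose j\<close> times \<open>(\<H> + \<alpha>) u\<^sub>k\<^sub>-\<^sub>j\<close> (\<open>L_op_ART\<close>). At \<open>j = k\<close>
  this is \<open>f\<close>. Every function met on the way is a multiple of some \<open>u\<^sub>n\<close>, hence differentiable
  in \<open>x\<close>.\<close>

section \<open>Functions of class \<open>C\<^sup>1\<close>\<close>

lemma Ck_on_open_SucD:
  "Ck_on_open (Suc n) f U \<Longrightarrow> Ck_on_open n f U"
proof (induction n arbitrary: f)
  case 0
  then show ?case
    by (auto intro!: continuous_at_imp_continuous_on differentiable_imp_continuous_within)
next
  case (Suc n)
  then show ?case by simp
qed

lemma Ck_on_open_imp_C1:
  "Ck_on_open (Suc n) f U \<Longrightarrow> Ck_on_open 1 f U"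
proof (induction n)
  case (Suc n)
  then show ?case using Ck_on_open_SucD by blast
qed simp

lemma C1_onI:
  assumes "\<And>x. x \<in> U \<Longrightarrow> (f has_derivative f' x) (at x)"
    and "\<And>v. continuous_on U (\<lambda>x. f' x v)"
  shows "Ck_on_open 1 f U"
proof -
  have "frechet_derivative f (at x) = f' x" if "x \<in> U" for x
    using frechet_derivative_at[OF assms(1)[OF that]] by simp
  then have "continuous_on U (\<lambda>x. frechet_derivative f (at x) v)" for v
    using assms(2)[of v] by (simp cong: continuous_on_cong)
  then show ?thesis
    using assms(1) by (auto simp: differentiable_def)
qed

lemma C1_onD:
  assumes "Ck_on_open 1 f U"
  shows "x \<in> U \<Longrightarrow> (f has_derivative frechet_derivative f (at x)) (at x)"
    and "continuous_on U (\<lambda>x. frechet_derivative f (at x) v)"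
  using assms by (auto simp: frechet_derivative_works)

lemma C1_subset:
  assumes "Ck_on_open 1 f U" "V \<subseteq> U"
  shows "Ck_on_open 1 f V"
  using C1_onD[OF assms(1)] assms(2)
  by (intro C1_onI) (auto intro: continuous_on_subset)

text \<open>The derivative is determined locally, so continuous differentiability can be checked on
  neighbourhoods, with a different local representative \<open>g\<close> on each. This matches the way in which
  functions on a submanifold are given.\<close>

lemma C1_local:
  fixes f :: "'a::euclidean_space \<Rightarrow> 'b::real_normed_vector"
  assumes loc: "\<And>x. \<exists>V g. open V \<and> x \<in> V \<and> Ck_on_open 1 g V \<and> (\<forall>y\<in>V. f y = g y)"
  shows "Ck_on_open 1 f UNIV"
proof -
  have C1: "Ck_on_open 1 f V"
    if V: "open V" and g: "Ck_on_open 1 g V" and eq: "\<forall>y\<in>V. f y = g y" for V g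
  proof (rule C1_onI)
    show "(f has_derivative frechet_derivative g (at x)) (at x)" if "x \<in> V" for x
      by (rule has_derivative_transform_within_open[OF C1_onD(1)[OF g that] V that])
        (simp add: eq)
  qed (rule C1_onD(2)[OF g])
  show ?thesis
  proof (rule C1_onI)
    fix x
    show "(f has_derivative frechet_derivative f (at x)) (at x)"
    proof -
      obtain V g where V: "open V" "x \<in> V" "Ck_on_open 1 g V" "\<forall>y\<in>V. f y = g y"
        using loc by blast
      show ?thesis
        using C1_onD(1)[OF C1[OF V(1,3,4)] V(2)] .
    qed
  next
    fix v
    show "continuous_on UNIV (\<lambda>x. frechet_derivative f (at x) v)"
    proof (rule continuous_at_imp_continuous_on, rule ballI)
      fix x
      obtain V g where V: "open V" "x \<in> V" "Ck_on_open 1 g V" "\<forall>y\<in>V. f y = g y"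
        using loc by blast
      show "isCont (\<lambda>x. frechet_derivative f (at x) v) x"
        using C1_onD(2)[OF C1[OF V(1,3,4)]] V(1,2) by (simp add: continuous_on_eq_continuous_at)
    qed
  qed
qed

text \<open>Near points of \<open>D\<close> local representatives are given; all other points lie in the open complement
  of \<open>K\<close>, where the function is zero.\<close>

lemma C1_extend_by_zero:
  fixes f :: "'a::euclidean_space \<Rightarrow> 'b::real_normed_vector"
  assumes "compact K" "K \<subseteq> D" and zero: "\<And>x. x \<notin> K \<Longrightarrow> f x = 0"
    and loc: "\<And>x. x \<in> D \<Longrightarrow> \<exists>V g. open V \<and> x \<in> V \<and> Ck_on_open 1 g V \<and> (\<forall>y\<in>V. f y = g y)"
  shows "Ck_on_open 1 f UNIV"
proof (rule C1_local)
  fix x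
  show "\<exists>V g. open V \<and> x \<in> V \<and> Ck_on_open 1 g V \<and> (\<forall>y\<in>V. f y = g y)"
  proof (cases "x \<in> D")
    case True
    then show ?thesis by (rule loc)
  next
    case False
    have "Ck_on_open 1 (\<lambda>_. 0 :: 'b) (- K)"
      by (rule C1_onI[where f' = "\<lambda>_ _. 0"]) auto
    moreover have "open (- K)"
      using assms(1) by (simp add: compact_imp_closed open_Compl)
    ultimately show ?thesis
      using False assms(2) zero by (intro exI[of _ "- K"] exI[of _ "\<lambda>_. 0"]) auto
  qed
qed

lemma C1_slice:
  fixes g :: "'a::euclidean_space \<times> 'c::euclidean_space \<Rightarrow> 'b::real_normed_vector"
  assumes "Ck_on_open 1 g U"
  shows "Ck_on_open 1 (\<lambda>y. g (y, \<xi>)) {y. (y, \<xi>) \<in> U}"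
proof (rule C1_onI)
  fix y assume "y \<in> {y. (y, \<xi>) \<in> U}"
  then have g: "(g has_derivative frechet_derivative g (at (y, \<xi>))) (at (y, \<xi>))"
    using C1_onD(1)[OF assms] by blast
  have "((\<lambda>y. (y, \<xi>)) has_derivative (\<lambda>v. (v, 0))) (at y)"
    by (auto intro!: derivative_eq_intros)
  from has_derivative_compose[OF this g]
  show "((\<lambda>y. g (y, \<xi>)) has_derivative (\<lambda>v. frechet_derivative g (at (y, \<xi>)) (v, 0))) (at y)" .
next
  fix v :: 'a
  show "continuous_on {y. (y, \<xi>) \<in> U} (\<lambda>y. frechet_derivative g (at (y, \<xi>)) (v, 0))"
    by (rule continuous_on_compose2[OF C1_onD(2)[OF assms, of "(v, 0)"]])
      (auto intro!: continuous_intros)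
qed

lemma C1_add:
  assumes "Ck_on_open 1 f U" "Ck_on_open 1 g U"
  shows "Ck_on_open 1 (\<lambda>x. f x + g x) U"
  using C1_onD[OF assms(1)] C1_onD[OF assms(2)]
  by (intro C1_onI[where f' = "\<lambda>x v. frechet_derivative f (at x) v + frechet_derivative g (at x) v"])
    (auto intro!: derivative_intros continuous_intros)

lemma C1_bounded_linear:
  assumes "bounded_linear T" "Ck_on_open 1 f U"
  shows "Ck_on_open 1 (\<lambda>x. T (f x)) U"
proof (rule C1_onI)
  show "((\<lambda>x. T (f x)) has_derivative (\<lambda>v. T (frechet_derivative f (at x) v))) (at x)"
    if "x \<in> U" for x
    using bounded_linear.has_derivative[OF assms(1)] C1_onD(1)[OF assms(2) that] .
  show "continuous_on U (\<lambda>x. T (frechet_derivative f (at x) v))" for v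
    using bounded_linear.continuous_on[OF assms(1)] C1_onD(2)[OF assms(2)] .
qed

lemma C1_sum:
  assumes "\<And>i. i \<in> I \<Longrightarrow> Ck_on_open 1 (f i) U"
  shows "Ck_on_open 1 (\<lambda>x. \<Sum>i\<in>I. f i x) U"
proof (rule C1_onI)
  show "((\<lambda>x. \<Sum>i\<in>I. f i x) has_derivative (\<lambda>v. \<Sum>i\<in>I. frechet_derivative (f i) (at x) v)) (at x)"
    if "x \<in> U" for x
    using C1_onD(1)[OF assms that] by (intro has_derivative_sum)
  show "continuous_on U (\<lambda>x. \<Sum>i\<in>I. frechet_derivative (f i) (at x) v)" for v
    using C1_onD(2)[OF assms] by (intro continuous_on_sum)
qed

text \<open>Differentiation under the integral sign needs a derivative that is continuous for the operator
  norm. In finite dimension this follows from continuity of the directional derivatives.\<close>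

lemma C1_UNIV_blinfunE:
  fixes f :: "'a::euclidean_space \<Rightarrow> 'b::real_normed_vector"
  assumes "Ck_on_open 1 f UNIV"
  obtains f' :: "'a \<Rightarrow> 'a \<Rightarrow>\<^sub>L 'b"
  where "\<And>x. (f has_derivative f' x) (at x)" "continuous_on UNIV f'"
proof
  let ?f' = "\<lambda>x. Blinfun (frechet_derivative f (at x))"
  note D = C1_onD[OF assms, simplified]
  have blinfun_eq: "blinfun_apply (?f' x) = frechet_derivative f (at x)" for x
    by (rule bounded_linear_Blinfun_apply) (rule has_derivative_bounded_linear[OF D(1)])
  show "(f has_derivative ?f' x) (at x)" for x
    using D(1) by (simp add: blinfun_eq)
  show "continuous_on UNIV ?f'"
    by (rule continuous_on_blinfun_componentwise) (simp add: blinfun_eq D(2))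
qed

section \<open>Slices of admissible functions and tensor fields\<close>

lemma C1_slice_of_admissible_function:
  fixes f :: "phase \<Rightarrow> 'b::real_normed_vector"
  assumes "admissible_function (Suc n) D f" and D: "open D" and \<xi>: "norm \<xi> = 1"
  shows "Ck_on_open 1 (\<lambda>y. f (y, \<xi>)) UNIV"
proof -
  obtain K where K: "compact K" "K \<subseteq> D" "\<And>y. y \<notin> K \<Longrightarrow> f (y, \<xi>) = 0"
    using assms(1) \<xi> unfolding admissible_function_def finite_in_x_def by auto
  show ?thesis
  proof (rule C1_extend_by_zero[OF K])
    fix x assume "x \<in> D"
    then have "(x, \<xi>) \<in> sphere_bundle D"
      using \<xi> by (simp add: sphere_bundle_def)
    then obtain U g where U: "open U" "(x, \<xi>) \<in> U" and g: "Ck_on_open (Suc n) g U"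
      and eq: "\<forall>q\<in>sphere_bundle D \<inter> U. f q = g q"
      using assms(1) unfolding admissible_function_def Ck_on_submanifold_def by blast
    define V where "V = D \<inter> {y. (y, \<xi>) \<in> U}"
    have "open {y. (y, \<xi>) \<in> U}"
      using open_vimage[OF U(1), of "\<lambda>y. (y, \<xi>)"] by (simp add: vimage_def continuous_intros)
    then have "open V" using D by (auto simp: V_def)
    moreover have "x \<in> V" using \<open>x \<in> D\<close> U by (simp add: V_def)
    moreover have "Ck_on_open 1 (\<lambda>y. g (y, \<xi>)) V"
      by (rule C1_subset[OF C1_slice[OF Ck_on_open_imp_C1[OF g]]]) (auto simp: V_def)
    moreover have "\<forall>y\<in>V. f (y, \<xi>) = g (y, \<xi>)"
      using eq \<xi> by (auto simp: V_def sphere_bundle_def)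
    ultimately show "\<exists>V g. open V \<and> x \<in> V \<and> Ck_on_open 1 g V \<and> (\<forall>y\<in>V. f (y, \<xi>) = g y)"
      by blast
  qed
qed

lemma C1_tensor_pairing:
  assumes w: "admissible_tensor_field (Suc n) m D w" and D: "open D"
  shows "Ck_on_open 1 (\<lambda>x. tensor_pairing m (w x) \<xi>) UNIV"
  unfolding tensor_pairing_def
proof (intro C1_sum C1_bounded_linear[where T = "\<lambda>z. z * c" for c] bounded_linear_mult_left)
  fix "is" :: "3 list" assume "is \<in> {is. length is = m}"
  then have len: "length is = m" by simp
  obtain K where K: "compact K" "K \<subseteq> D" "\<And>x. x \<notin> K \<Longrightarrow> w x is = 0"
    using w len unfolding admissible_tensor_field_def by blast
  have "Ck_on_open 1 (\<lambda>x. w x is) D"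
    using w len Ck_on_open_imp_C1 unfolding admissible_tensor_field_def by blast
  then show "Ck_on_open 1 (\<lambda>x. w x is) UNIV"
    using D by (intro C1_extend_by_zero[OF K] exI[of _ D] exI[of _ "\<lambda>x. w x is"]) auto
qed

section \<open>Integrals along a ray\<close>

text \<open>Rescaling to a fixed interval turns the dependence on the endpoint \<open>s\<close> into a dependence of the
  integrand on a parameter.\<close>

lemma integral_from_0_rescale:
  fixes g :: "real \<Rightarrow> 'b::real_normed_vector"
  assumes "0 \<le> s"
  shows "integral {0..s} g = s *\<^sub>R integral {0..1} (\<lambda>r. g (s * r))"
proof (cases "s = 0")
  case False
  then have "(\<lambda>x. x / s) ` {0..s} = {0..1}"
    using assms by (simp add: image_divide_atLeastAtMost)
  then show ?thesis
    using integral_stretch_real[of s 0 s g] False assms by simp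
qed simp

lemma continuous_on_ray_integral:
  fixes b :: "'a::euclidean_space \<Rightarrow> 'b::banach"
  assumes "continuous_on UNIV b"
  shows "continuous_on (UNIV \<times> {0..M}) (\<lambda>(y, s). integral {0..s} (\<lambda>\<sigma>. b (y - \<sigma> *\<^sub>R \<xi>)))"
proof -
  have "continuous_on ((UNIV \<times> {0..M}) \<times> cbox 0 1)
      (\<lambda>(p, r). b (fst p - (snd p * r) *\<^sub>R \<xi>))"
    unfolding split_beta
    by (rule continuous_on_compose2[OF assms]) (auto intro!: continuous_intros)
  then have "continuous_on (UNIV \<times> {0..M})
      (\<lambda>p. integral (cbox 0 1) (\<lambda>r. b (fst p - (snd p * r) *\<^sub>R \<xi>)))"
    by (rule integral_continuous_on_param)
  then have "continuous_on (UNIV \<times> {0..M})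
      (\<lambda>p. snd p *\<^sub>R integral {0..1} (\<lambda>r. b (fst p - (snd p * r) *\<^sub>R \<xi>)))"
    unfolding cbox_interval by (rule continuous_on_scaleR[OF continuous_on_snd[OF continuous_on_id]])
  then show ?thesis
  proof (rule continuous_on_eq)
    fix p :: "'a \<times> real" assume "p \<in> UNIV \<times> {0..M}"
    then show "snd p *\<^sub>R integral {0..1} (\<lambda>r. b (fst p - (snd p * r) *\<^sub>R \<xi>)) =
        (case p of (y, s) \<Rightarrow> integral {0..s} (\<lambda>\<sigma>. b (y - \<sigma> *\<^sub>R \<xi>)))"
      using integral_from_0_rescale[of "snd p" "\<lambda>\<sigma>. b (fst p - \<sigma> *\<^sub>R \<xi>)"]
      by (auto simp: mem_Times_iff split_beta)
  qed
qed

lemma has_derivative_ray_integral: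
  fixes b :: "'a::euclidean_space \<Rightarrow> 'b::banach" and b' :: "'a \<Rightarrow> 'a \<Rightarrow>\<^sub>L 'b"
  assumes b: "\<And>x. (b has_derivative b' x) (at x)" and b': "continuous_on UNIV b'"
  shows "((\<lambda>y. integral {0..s} (\<lambda>\<sigma>. b (y - \<sigma> *\<^sub>R \<xi>))) has_derivative
            integral {0..s} (\<lambda>\<sigma>. b' (y - \<sigma> *\<^sub>R \<xi>))) (at y)"
proof -
  have cont: "continuous_on UNIV b"
    by (intro continuous_at_imp_continuous_on ballI has_derivative_continuous[OF b])
  have "((\<lambda>y. integral (cbox 0 s) (\<lambda>\<sigma>. b (y - \<sigma> *\<^sub>R \<xi>))) has_derivative
            integral (cbox 0 s) (\<lambda>\<sigma>. b' (y - \<sigma> *\<^sub>R \<xi>))) (at y within UNIV)"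
  proof (rule leibniz_rule)
    fix y \<sigma>
    have "((\<lambda>y. y - \<sigma> *\<^sub>R \<xi>) has_derivative (\<lambda>v. v)) (at y)"
      by (auto intro!: derivative_eq_intros)
    from has_derivative_compose[OF this b]
    show "((\<lambda>y. b (y - \<sigma> *\<^sub>R \<xi>)) has_derivative b' (y - \<sigma> *\<^sub>R \<xi>)) (at y within UNIV)"
      by simp
    show "(\<lambda>\<sigma>. b (y - \<sigma> *\<^sub>R \<xi>)) integrable_on cbox 0 s"
      by (intro integrable_continuous continuous_on_compose2[OF cont])
        (auto intro!: continuous_intros)
  next
    show "continuous_on (UNIV \<times> cbox 0 s) (\<lambda>(y, \<sigma>). b' (y - \<sigma> *\<^sub>R \<xi>))"
      unfolding split_beta
      by (rule continuous_on_compose2[OF b']) (auto intro!: continuous_intros)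
  qed auto
  then show ?thesis by (simp add: cbox_interval)
qed

text \<open>Along its own ray the integrand is an exact derivative, so differentiating the integral in the
  direction \<open>\<xi>\<close> leaves only the endpoint values.\<close>

lemma ray_integral_derivative_along_ray:
  fixes b :: "'a::euclidean_space \<Rightarrow> 'b::banach" and b' :: "'a \<Rightarrow> 'a \<Rightarrow>\<^sub>L 'b"
  assumes b: "\<And>x. (b has_derivative b' x) (at x)" and b': "continuous_on UNIV b'"
    and "0 \<le> s"
  shows "integral {0..s} (\<lambda>\<sigma>. b' (y - \<sigma> *\<^sub>R \<xi>)) \<xi> = b y - b (y - s *\<^sub>R \<xi>)"
proof -
  have "((\<lambda>\<sigma>. - b (y - \<sigma> *\<^sub>R \<xi>)) has_vector_derivative b' (y - \<sigma> *\<^sub>R \<xi>) \<xi>) (at \<sigma> within {0..s})" for \<sigma>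
  proof -
    have "((\<lambda>\<sigma>. y - \<sigma> *\<^sub>R \<xi>) has_derivative (\<lambda>t. - (t *\<^sub>R \<xi>))) (at \<sigma> within {0..s})"
      by (auto intro!: derivative_eq_intros)
    from has_derivative_minus[OF has_derivative_compose[OF this b]]
    show ?thesis
      by (simp add: has_vector_derivative_def blinfun.minus_right blinfun.scaleR_right)
  qed
  then have "((\<lambda>\<sigma>. b' (y - \<sigma> *\<^sub>R \<xi>) \<xi>) has_integral - b (y - s *\<^sub>R \<xi>) - - b (y - 0 *\<^sub>R \<xi>)) {0..s}"
    using assms(3) by (rule fundamental_theorem_of_calculus[rotated])
  then have "integral {0..s} (\<lambda>\<sigma>. b' (y - \<sigma> *\<^sub>R \<xi>) \<xi>) = b y - b (y - s *\<^sub>R \<xi>)"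
    by (simp add: integral_unique)
  moreover have "(\<lambda>\<sigma>. b' (y - \<sigma> *\<^sub>R \<xi>)) integrable_on {0..s}"
    by (intro integrable_continuous_real continuous_on_compose2[OF b'])
      (auto intro!: continuous_intros)
  ultimately show ?thesis
    by (simp add: blinfun_apply_integral)
qed

section \<open>The transport recursion for a fixed direction\<close>

text \<open>The attenuated ray transform of order \<open>k\<close> with \<open>\<xi>\<close> frozen: \<open>a\<close> and \<open>F\<close> stand for the slices
  \<open>\<alpha>(\<cdot>, \<xi>)\<close> and \<open>f(\<cdot>, \<xi>)\<close>.\<close>

definition ray_moment ::
    "'a::euclidean_space \<Rightarrow> ('a \<Rightarrow> complex) \<Rightarrow> nat \<Rightarrow> ('a \<Rightarrow> complex) \<Rightarrow> 'a \<Rightarrow> complex" where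
  "ray_moment \<xi> a k F x = integral {0..} (\<lambda>s. of_real (s ^ k) *
     exp (- integral {0..s} (\<lambda>\<sigma>. a (x - \<sigma> *\<^sub>R \<xi>))) * F (x - s *\<^sub>R \<xi>))"

lemma integral_truncate:
  fixes f :: "real \<Rightarrow> 'b::banach"
  assumes "\<And>s. s > M \<Longrightarrow> f s = 0"
  shows "integral {0..} f = integral {0..M} f"
proof -
  have "integral UNIV (\<lambda>s. if s \<in> {0..} then f s else 0) =
      integral UNIV (\<lambda>s. if s \<in> {0..M} then f s else 0)"
    using assms by (intro arg_cong[where f = "integral UNIV"]) auto
  then show ?thesis by (simp only: integral_restrict_UNIV)
qed

text \<open>The derivative comes from differentiation under the integral sign; since \<open>F\<close> has bounded
  support, near \<open>x\<close> the half-line can be replaced by a fixed interval \<open>{0..M}\<close>. Its value at \<open>\<xi>\<close> comes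
  from comparing the derivative of the integrand along \<open>\<xi>\<close> with its derivative in \<open>s\<close>, and from
  integration by parts.\<close>

lemma ray_moment_transport:
  fixes a F :: "'a::euclidean_space \<Rightarrow> complex"
  assumes "Ck_on_open 1 a UNIV" "Ck_on_open 1 F UNIV"
    and "bounded {y. F y \<noteq> 0}"
    and unit: "norm \<xi> = 1"
  obtains G where "(ray_moment \<xi> a k F has_derivative G) (at x)"
    and "G \<xi> = (if k = 0 then F x else of_nat k * ray_moment \<xi> a (k - 1) F x)
      - a x * ray_moment \<xi> a k F x"
proof -
  obtain a' where a: "\<And>y. (a has_derivative blinfun_apply (a' y)) (at y)" "continuous_on UNIV a'"
    using C1_UNIV_blinfunE[OF assms(1)] by blast
  obtain F' where F: "\<And>y. (F has_derivative blinfun_apply (F' y)) (at y)" "continuous_on UNIV F'"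
    using C1_UNIV_blinfunE[OF assms(2)] by blast
  obtain R where supp: "\<And>y. norm y > R \<Longrightarrow> F y = 0"
    using assms(3) unfolding bounded_iff by (metis (mono_tags, lifting) mem_Collect_eq not_le)
  have cont: "continuous_on UNIV a" "continuous_on UNIV F"
    by (intro continuous_at_imp_continuous_on ballI has_derivative_continuous[OF a(1)]
        has_derivative_continuous[OF F(1)])+
  \<comment> \<open>For \<open>y\<close> in the unit ball around \<open>x\<close>, the point \<open>y - s \<xi>\<close> has norm greater than \<open>R\<close> once \<open>s > M\<close>.\<close>
  define M where "M = \<bar>R\<bar> + norm x + 1"
  have M: "M \<ge> 0" by (simp add: M_def)
  define P where "P = (\<lambda>y s. integral {0..s} (\<lambda>\<sigma>. a (y - \<sigma> *\<^sub>R \<xi>)))"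
  define P' where "P' = (\<lambda>y s. integral {0..s} (\<lambda>\<sigma>. a' (y - \<sigma> *\<^sub>R \<xi>)))"
  \<comment> \<open>The integrand is needed for both orders \<open>k\<close> and \<open>k - 1\<close>, its derivative in \<open>y\<close> only for \<open>k\<close>.\<close>
  define h where "h = (\<lambda>n y s. of_real (s ^ n) * exp (- P y s) * F (y - s *\<^sub>R \<xi>))"
  define h' where "h' = (\<lambda>y s. blinfun_mult_right (of_real (s ^ k) * exp (- P y s)) o\<^sub>L
      (F' (y - s *\<^sub>R \<xi>) - (blinfun_mult_right (F (y - s *\<^sub>R \<xi>)) o\<^sub>L P' y s)))"
  let ?Q = "UNIV \<times> {0..M} :: ('a \<times> real) set"
  have contP: "continuous_on ?Q (\<lambda>p. P (fst p) (snd p))"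
    using continuous_on_ray_integral[OF cont(1)] by (simp add: P_def split_beta)
  have contP': "continuous_on ?Q (\<lambda>p. P' (fst p) (snd p))"
    using continuous_on_ray_integral[OF a(2)] by (simp add: P'_def split_beta)
  have shift: "continuous_on ?Q (\<lambda>p. fst p - snd p *\<^sub>R \<xi>)"
    by (intro continuous_intros)
  have contF: "continuous_on ?Q (\<lambda>p. F (fst p - snd p *\<^sub>R \<xi>))"
    by (rule continuous_on_compose2[OF cont(2) shift]) simp
  have contF': "continuous_on ?Q (\<lambda>p. F' (fst p - snd p *\<^sub>R \<xi>))"
    by (rule continuous_on_compose2[OF F(2) shift]) simp
  have conth: "continuous_on ?Q (\<lambda>p. h n (fst p) (snd p))" for n
    unfolding h_def by (intro continuous_intros contP contF)
  have conth': "continuous_on ?Q (\<lambda>p. h' (fst p) (snd p))"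
    unfolding h'_def
    by (intro bounded_bilinear.continuous_on[OF bounded_bilinear_blinfun_compose]
        bounded_linear.continuous_on[OF bounded_linear_blinfun_mult_right]
        continuous_on_diff continuous_on_mult continuous_on_exp continuous_on_minus
        contP contP' contF contF') (intro continuous_intros)
  have cont_Pair: "continuous_on {0..M} (\<lambda>s. (y, s))" for y :: 'a
    by (intro continuous_intros)
  have int_h: "h n y integrable_on {0..M}" for n y
    using continuous_on_compose2[OF conth cont_Pair[of y]]
    by (intro integrable_continuous_real) (auto simp: image_subset_iff)
  have int_h': "h' y integrable_on {0..M}" for y
    using continuous_on_compose2[OF conth' cont_Pair[of y]]
    by (intro integrable_continuous_real) (auto simp: image_subset_iff)
  have trunc: "ray_moment \<xi> a n F y = integral {0..M} (h n y)" if "y \<in> ball x 1" for n y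
  proof -
    have "norm y < norm x + 1"
      using that norm_triangle_sub[of y x] by (simp add: dist_norm norm_minus_commute)
    have "F (y - s *\<^sub>R \<xi>) = 0" if "s > M" for s
    proof (rule supp)
      have "s > 0" using that M by simp
      then show "norm (y - s *\<^sub>R \<xi>) > R"
        using that \<open>norm y < norm x + 1\<close> norm_triangle_ineq3[of y "s *\<^sub>R \<xi>"] unit
        by (simp add: M_def)
    qed
    then show ?thesis
      unfolding ray_moment_def h_def P_def by (intro integral_truncate) simp
  qed
  have deriv_h: "((\<lambda>y. h k y s) has_derivative h' y s) (at y)" for y s
  proof -
    have "((\<lambda>y. y - s *\<^sub>R \<xi>) has_derivative (\<lambda>v. v)) (at y)"
      by (auto intro!: derivative_eq_intros)
    note dF = has_derivative_compose[OF this F(1)]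
    have "((\<lambda>y. - P y s) has_derivative (\<lambda>v. - P' y s v)) (at y)"
      unfolding P_def P'_def by (intro has_derivative_minus has_derivative_ray_integral a)
    note dE = has_derivative_compose[OF this DERIV_exp[unfolded has_field_derivative_def]]
    show ?thesis
      unfolding h_def h'_def
      by (rule has_derivative_eq_rhs[OF has_derivative_mult[OF has_derivative_mult_right[OF dE] dF]])
        (simp add: fun_eq_iff blinfun.diff_left algebra_simps)
  qed
  let ?G = "integral {0..M} (h' x)"
  have "((\<lambda>y. integral (cbox 0 M) (h k y)) has_derivative integral (cbox 0 M) (h' x))
      (at x within UNIV)"
    using int_h deriv_h conth'
    by (intro leibniz_rule) (auto simp: cbox_interval split_beta)
  then have "((\<lambda>y. integral {0..M} (h k y)) has_derivative ?G) (at x)"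
    by (simp add: cbox_interval)
  then have deriv: "(ray_moment \<xi> a k F has_derivative ?G) (at x)"
    by (rule has_derivative_transform_within_open[of _ _ _ _ "ball x 1"]) (simp_all add: trunc)
  \<comment> \<open>The integrand without the factor \<open>s ^ k\<close>, now as a function of \<open>s\<close> alone; \<open>a (x - s *\<^sub>R \<xi>)\<close>
    appears in its derivative through the upper endpoint of \<open>P x s\<close>.\<close>
  define g where "g = (\<lambda>s. exp (- P x s) * F (x - s *\<^sub>R \<xi>))"
  define g' where "g' = (\<lambda>s. - a (x - s *\<^sub>R \<xi>) * g s - exp (- P x s) * F' (x - s *\<^sub>R \<xi>) \<xi>)"
  have deriv_g: "(g has_vector_derivative g' s) (at s within {0..M})" if "s \<in> {0..M}" for s
  proof -
    have "(P x has_vector_derivative a (x - s *\<^sub>R \<xi>)) (at s within {0..M})"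
      unfolding P_def using that
      by (intro integral_has_vector_derivative continuous_on_compose2[OF cont(1)])
        (auto intro!: continuous_intros)
    then have "((\<lambda>s. - P x s) has_derivative (\<lambda>t. - (t *\<^sub>R a (x - s *\<^sub>R \<xi>)))) (at s within {0..M})"
      unfolding has_vector_derivative_def by (rule has_derivative_minus)
    note dE = has_derivative_compose[OF this DERIV_exp[unfolded has_field_derivative_def]]
    have "((\<lambda>s. x - s *\<^sub>R \<xi>) has_derivative (\<lambda>t. - (t *\<^sub>R \<xi>))) (at s within {0..M})"
      by (auto intro!: derivative_eq_intros)
    note dF = has_derivative_compose[OF this F(1)]
    show ?thesis
      unfolding g_def g'_def has_vector_derivative_def
      by (rule has_derivative_eq_rhs[OF has_derivative_mult[OF dE dF]])
        (simp add: fun_eq_iff blinfun.minus_right blinfun.scaleR_right scaleR_conv_of_real algebra_simps)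
  qed
  \<comment> \<open>Integration by parts. The boundary term at \<open>0\<close> survives only for \<open>k = 0\<close>, because \<open>0 ^ 0 = 1\<close>; in that
    case the factor \<open>of_nat k\<close> annihilates the term with the truncated order \<open>k - 1\<close>.\<close>
  have "((\<lambda>s. of_nat k * h (k - 1) x s + of_real (s ^ k) * g' s) has_integral
      of_real (M ^ k) * g M - of_real (0 ^ k) * g 0) {0..M}"
  proof (rule fundamental_theorem_of_calculus[OF M])
    fix s assume s: "s \<in> {0..M}"
    have "((\<lambda>s. s ^ k) has_real_derivative of_nat k * s ^ (k - 1)) (at s within {0..M})"
      by (auto intro!: derivative_eq_intros)
    from has_vector_derivative_of_real[OF this]
    have "((\<lambda>s. of_real (s ^ k) :: complex) has_vector_derivative of_real (of_nat k * s ^ (k - 1)))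
        (at s within {0..M})" .
    from has_vector_derivative_mult[OF this deriv_g[OF s]]
    show "((\<lambda>s. of_real (s ^ k) * g s) has_vector_derivative
        of_nat k * h (k - 1) x s + of_real (s ^ k) * g' s) (at s within {0..M})"
      by (rule has_vector_derivative_eq_rhs) (simp add: h_def g_def algebra_simps)
  qed
  moreover have "g M = 0"
  proof -
    have "norm (x - M *\<^sub>R \<xi>) > R"
      using norm_triangle_ineq3[of x "M *\<^sub>R \<xi>"] unit M by (simp add: M_def)
    then show ?thesis by (simp add: g_def supp)
  qed
  moreover have "g 0 = F x" by (simp add: g_def P_def)
  ultimately have parts: "((\<lambda>s. of_nat k * h (k - 1) x s + of_real (s ^ k) * g' s) has_integral
      - (if k = 0 then F x else 0)) {0..M}"
    by (cases k) auto
  \<comment> \<open>The derivatives of the exponent \<open>- P\<close> along \<open>\<xi>\<close> and in \<open>s\<close> add up to \<open>- a x\<close>. The term \<open>of_nat k * h (k - 1) x s\<close> is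
    added and subtracted so that the bracket is the integrand of \<open>parts\<close>.\<close>
  have along: "h' x s \<xi> = of_nat k * h (k - 1) x s - a x * h k x s
      - (of_nat k * h (k - 1) x s + of_real (s ^ k) * g' s)" if "s \<in> {0..M}" for s
  proof -
    have "P' x s \<xi> = a x - a (x - s *\<^sub>R \<xi>)"
      unfolding P'_def using that by (intro ray_integral_derivative_along_ray a) auto
    then have "h' x s \<xi> = of_real (s ^ k) * exp (- P x s) *
        (F' (x - s *\<^sub>R \<xi>) \<xi> - F (x - s *\<^sub>R \<xi>) * (a x - a (x - s *\<^sub>R \<xi>)))"
      by (simp add: h'_def blinfun.diff_left)
    then show ?thesis
      by (simp add: h_def g'_def g_def algebra_simps)
  qed
  have "((\<lambda>s. of_nat k * h (k - 1) x s - a x * h k x s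
      - (of_nat k * h (k - 1) x s + of_real (s ^ k) * g' s)) has_integral
      of_nat k * integral {0..M} (h (k - 1) x) - a x * integral {0..M} (h k x)
      - - (if k = 0 then F x else 0)) {0..M}"
    by (intro has_integral_diff parts has_integral_mult_right integrable_integral int_h)
  then have "((\<lambda>s. h' x s \<xi>) has_integral
      of_nat k * integral {0..M} (h (k - 1) x) - a x * integral {0..M} (h k x)
      - - (if k = 0 then F x else 0)) {0..M}"
    by (rule has_integral_eq[rotated]) (simp add: along)
  then have "?G \<xi> = of_nat k * integral {0..M} (h (k - 1) x) - a x * integral {0..M} (h k x)
      - - (if k = 0 then F x else 0)"
    by (simp add: blinfun_apply_integral[OF int_h'] integral_unique)
  then have "?G \<xi> = (if k = 0 then F x else of_nat k * ray_moment \<xi> a (k - 1) F x)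
      - a x * ray_moment \<xi> a k F x"
    by (simp add: trunc)
  with deriv show ?thesis by (rule that)
qed

section \<open>The iterated operators applied to the transform\<close>

lemma ART_eq_ray_moment:
  "ART \<alpha> k f (x, \<xi>) = ray_moment \<xi> (\<lambda>y. \<alpha> (y, \<xi>)) k (\<lambda>y. f (y, \<xi>)) x"
  by (simp add: ART_def ray_moment_def)

lemma H_op_eq_derivative:
  assumes "((\<lambda>y. \<psi> (y, \<xi>)) has_derivative G) (at x)"
  shows "H_op \<psi> (x, \<xi>) = G \<xi>"
proof -
  have "((\<lambda>\<tau>. x + \<tau> *\<^sub>R \<xi>) has_derivative (\<lambda>\<tau>. \<tau> *\<^sub>R \<xi>)) (at 0)"
    by (auto intro!: derivative_eq_intros)
  from has_derivative_compose[OF this, of "\<lambda>y. \<psi> (y, \<xi>)" G] assms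
  have "((\<lambda>\<tau>. \<psi> (x + \<tau> *\<^sub>R \<xi>, \<xi>)) has_derivative (\<lambda>\<tau>. G (\<tau> *\<^sub>R \<xi>))) (at 0)"
    by simp
  then have "((\<lambda>\<tau>. \<psi> (x + \<tau> *\<^sub>R \<xi>, \<xi>)) has_vector_derivative G \<xi>) (at 0)"
    by (simp add: has_vector_derivative_def linear_cmul[OF has_derivative_linear[OF assms]])
  then show ?thesis
    by (simp add: H_op_def vector_derivative_at)
qed

lemma H_op_cong:
  assumes "\<And>y. \<psi> (y, \<xi>) = \<phi> (y, \<xi>)"
  shows "H_op \<psi> (x, \<xi>) = H_op \<phi> (x, \<xi>)"
  by (simp add: H_op_def assms)

lemma H_op_cmult:
  assumes "(\<lambda>y. \<psi> (y, \<xi>)) differentiable (at x)"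
  shows "H_op (\<lambda>p. c * \<psi> p) (x, \<xi>) = c * H_op \<psi> (x, \<xi>)"
proof -
  obtain G where G: "((\<lambda>y. \<psi> (y, \<xi>)) has_derivative G) (at x)"
    using assms by (auto simp: differentiable_def)
  show ?thesis
    using H_op_eq_derivative[OF G] H_op_eq_derivative[OF has_derivative_mult_right[OF G, of c]]
    by simp
qed

lemma ART_transport:
  assumes \<alpha>: "Ck_on_open 1 (\<lambda>y. \<alpha> (y, \<xi>)) UNIV"
    and f: "Ck_on_open 1 (\<lambda>y. f (y, \<xi>)) UNIV"
    and supp: "bounded {y. f (y, \<xi>) \<noteq> 0}"
    and \<xi>: "norm \<xi> = 1"
  shows "(\<lambda>y. ART \<alpha> k f (y, \<xi>)) differentiable (at x)"
    and "H_op (ART \<alpha> k f) (x, \<xi>) + \<alpha> (x, \<xi>) * ART \<alpha> k f (x, \<xi>) =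
      (if k = 0 then f (x, \<xi>) else of_nat k * ART \<alpha> (k - 1) f (x, \<xi>))"
proof -
  obtain G where G: "((\<lambda>y. ART \<alpha> k f (y, \<xi>)) has_derivative G) (at x)"
    and G\<xi>: "G \<xi> = (if k = 0 then f (x, \<xi>) else of_nat k * ART \<alpha> (k - 1) f (x, \<xi>))
      - \<alpha> (x, \<xi>) * ART \<alpha> k f (x, \<xi>)"
    unfolding ART_eq_ray_moment by (rule ray_moment_transport[OF \<alpha> f supp \<xi>])
  show "(\<lambda>y. ART \<alpha> k f (y, \<xi>)) differentiable (at x)"
    using G by (auto simp: differentiable_def)
  show "H_op (ART \<alpha> k f) (x, \<xi>) + \<alpha> (x, \<xi>) * ART \<alpha> k f (x, \<xi>) =
      (if k = 0 then f (x, \<xi>) else of_nat k * ART \<alpha> (k - 1) f (x, \<xi>))"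
    using H_op_eq_derivative[OF G] G\<xi> by simp
qed

text \<open>By induction on \<open>j\<close>: applying \<open>\<H> + \<alpha>\<close> to \<open>(k - j) u\<^sub>k\<^sub>-\<^sub>j\<^sub>-\<^sub>1\<close> and dividing by \<open>j + 1\<close> multiplies the
  coefficient by \<open>(k - j) / (j + 1)\<close>, which takes \<open>k choose j\<close> to \<open>k choose (j + 1)\<close>. The induction needs
  the identity at all \<open>x\<close>, since \<open>\<H>\<close> differentiates in \<open>x\<close>.\<close>

lemma L_op_ART:
  assumes \<alpha>: "Ck_on_open 1 (\<lambda>y. \<alpha> (y, \<xi>)) UNIV"
    and f: "Ck_on_open 1 (\<lambda>y. f (y, \<xi>)) UNIV"
    and supp: "bounded {y. f (y, \<xi>) \<noteq> 0}"
    and \<xi>: "norm \<xi> = 1"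
    and "j \<le> k"
  shows "L_op \<alpha> (Suc j) (ART \<alpha> k f) (x, \<xi>) = of_nat (k choose j) *
    (if j = k then f (x, \<xi>) else of_nat (k - j) * ART \<alpha> (k - Suc j) f (x, \<xi>))"
  using \<open>j \<le> k\<close>
proof (induction j arbitrary: x)
  case 0
  show ?case
    using ART_transport(2)[of \<alpha> \<xi> f, OF \<alpha> f supp \<xi>] by simp
next
  case (Suc j)
  then have "j < k" by simp
  define c :: complex where "c = of_nat (k choose j) * of_nat (k - j)"
  let ?u = "ART \<alpha> (k - Suc j) f"
  have IH: "L_op \<alpha> (Suc j) (ART \<alpha> k f) (y, \<xi>) = c * ?u (y, \<xi>)" for y
    using Suc.IH[of y] \<open>j < k\<close> by (simp add: c_def)
  have c: "c = of_nat (Suc j) * of_nat (k choose Suc j)"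
    using gbinomial_mult_1[of "of_nat k :: complex" j] \<open>j < k\<close>
    by (simp add: c_def binomial_gbinomial of_nat_diff algebra_simps)
  have "L_op \<alpha> (Suc (Suc j)) (ART \<alpha> k f) (x, \<xi>) =
      1 / of_nat (Suc j) * (H_op (\<lambda>p. c * ?u p) (x, \<xi>) + \<alpha> (x, \<xi>) * (c * ?u (x, \<xi>)))"
    using H_op_cong[of "L_op \<alpha> (Suc j) (ART \<alpha> k f)" \<xi> "\<lambda>p. c * ?u p" x] by (simp add: IH)
  also have "\<dots> = c / of_nat (Suc j) * (H_op ?u (x, \<xi>) + \<alpha> (x, \<xi>) * ?u (x, \<xi>))"
    using ART_transport(1)[of \<alpha> _ f, OF \<alpha> f supp \<xi>] by (simp add: H_op_cmult algebra_simps)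
  also have "\<dots> = of_nat (k choose Suc j) * (if k - Suc j = 0 then f (x, \<xi>)
      else of_nat (k - Suc j) * ART \<alpha> (k - Suc j - 1) f (x, \<xi>))"
    unfolding c ART_transport(2)[of \<alpha> \<xi> f, OF \<alpha> f supp \<xi>] by (simp del: of_nat_Suc)
  finally show ?case
    using Suc.prems by (simp split: if_splits)
qed

lemma solves_L_equation_ART:
  assumes \<alpha>: "\<And>\<xi>. norm \<xi> = 1 \<Longrightarrow> Ck_on_open 1 (\<lambda>y. \<alpha> (y, \<xi>)) UNIV"
    and f: "\<And>\<xi>. norm \<xi> = 1 \<Longrightarrow> Ck_on_open 1 (\<lambda>y. f (y, \<xi>)) UNIV"
    and fin: "finite_in_x D f"
  shows "solves_L_equation D \<alpha> (Suc k) (ART \<alpha> k f) f"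
proof -
  have supp: "bounded {y. f (y, \<xi>) \<noteq> 0}" if "norm \<xi> = 1" for \<xi>
  proof -
    obtain K where "compact K" "\<forall>x \<xi>. x \<notin> K \<longrightarrow> \<xi> \<in> sphere 0 1 \<longrightarrow> f (x, \<xi>) = 0"
      using fin unfolding finite_in_x_def by blast
    then show ?thesis
      using that by (intro bounded_subset[OF compact_imp_bounded, of K]) auto
  qed
  have diff: "(\<lambda>y. L_op \<alpha> j (ART \<alpha> k f) (y, \<xi>)) differentiable (at x)"
    if "j \<le> k" and \<xi>: "norm \<xi> = 1" for j x \<xi>
  proof (cases j)
    case 0
    then show ?thesis
      using ART_transport(1)[of \<alpha> _ f, OF \<alpha>[OF \<xi>] f[OF \<xi>] supp[OF \<xi>] \<xi>] by simp
  next
    case (Suc i)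
    then have "i < k" using that by simp
    then have "(\<lambda>y. L_op \<alpha> j (ART \<alpha> k f) (y, \<xi>)) = (\<lambda>y. of_nat (k choose i) *
        (of_nat (k - i) * ART \<alpha> (k - Suc i) f (y, \<xi>)))"
      using L_op_ART[of \<alpha> _ f, OF \<alpha>[OF \<xi>] f[OF \<xi>] supp[OF \<xi>] \<xi>, of i k] by (simp add: Suc fun_eq_iff)
    then show ?thesis
      using ART_transport(1)[of \<alpha> _ f, OF \<alpha>[OF \<xi>] f[OF \<xi>] supp[OF \<xi>] \<xi>]
      by (simp add: differentiable_mult)
  qed
  have "L_op \<alpha> (Suc k) (ART \<alpha> k f) (x, \<xi>) = f (x, \<xi>)" if \<xi>: "norm \<xi> = 1" for x \<xi>
    using L_op_ART[of \<alpha> _ f, OF \<alpha>[OF \<xi>] f[OF \<xi>] supp[OF \<xi>] \<xi>, of k k] by simp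
  with diff show ?thesis
    by (auto simp: solves_L_equation_def sphere_bundle_def simp del: L_op.simps)
qed

theorem theorem2p4:
  fixes D :: "(real^3) set" and k :: nat
    and \<epsilon> \<rho> :: "(real^3) \<times> (real^3) \<Rightarrow> real"
    and \<alpha> :: "(real^3) \<times> (real^3) \<Rightarrow> complex"
  assumes "bounded_convex_smooth_domain D"
    and "admissible_function (k + 1) D \<epsilon>"
    and "\<forall>p\<in>sphere_bundle D. \<epsilon> p \<ge> 0"
    and "admissible_function (k + 1) D \<rho>"
    and "\<alpha> = (\<lambda>p. complex_of_real (\<epsilon> p) + \<i> * complex_of_real (\<rho> p))"
  shows "(\<forall>f :: (real^3) \<times> (real^3) \<Rightarrow> complex. admissible_function (k + 1) D f \<longrightarrow>
            solves_L_equation D \<alpha> (k + 1) (ART \<alpha> k f) f) \<and>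
         (\<forall>(m :: nat) (w :: real^3 \<Rightarrow> 3 list \<Rightarrow> complex) (f :: (real^3) \<times> (real^3) \<Rightarrow> complex).
            admissible_tensor_field (k + 1) m D w \<longrightarrow>
            (\<forall>x. \<forall>\<xi>\<in>sphere 0 1. f (x, \<xi>) = tensor_pairing m (w x) \<xi>) \<longrightarrow>
            solves_L_equation D \<alpha> (k + 1) (ART \<alpha> k f) (\<lambda>(x, \<xi>). tensor_pairing m (w x) \<xi>))"
proof -
  have D: "open D"
    using assms(1) by (simp add: bounded_convex_smooth_domain_def)
  note slice = C1_slice_of_admissible_function[OF _ D]
  have \<alpha>: "Ck_on_open 1 (\<lambda>y. \<alpha> (y, \<xi>)) UNIV" if "norm \<xi> = 1" for \<xi>
    unfolding assms(5)
    using slice[of k \<epsilon> \<xi>] slice[of k \<rho> \<xi>] assms(2,4) that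
    by (intro C1_add C1_bounded_linear[OF bounded_linear_mult_right]
        C1_bounded_linear[OF bounded_linear_of_real]) simp_all
  have "solves_L_equation D \<alpha> (k + 1) (ART \<alpha> k f) f" if "admissible_function (k + 1) D f"
    for f :: "phase \<Rightarrow> complex"
    using solves_L_equation_ART[OF \<alpha> slice[of k f]] that
    by (simp add: admissible_function_def)
  moreover have "solves_L_equation D \<alpha> (k + 1) (ART \<alpha> k f) (\<lambda>(x, \<xi>). tensor_pairing m (w x) \<xi>)"
    if w: "admissible_tensor_field (k + 1) m D w"
      and f: "\<forall>x. \<forall>\<xi>\<in>sphere 0 1. f (x, \<xi>) = tensor_pairing m (w x) \<xi>"
    for m w and f :: "phase \<Rightarrow> complex"
  proof -
    have feq: "f (x, \<xi>) = tensor_pairing m (w x) \<xi>" if "norm \<xi> = 1" for x \<xi>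
      using f that by simp
    have "Ck_on_open 1 (\<lambda>y. f (y, \<xi>)) UNIV" if "norm \<xi> = 1" for \<xi>
      using C1_tensor_pairing[of k m D w \<xi>] w D by (simp add: feq[OF that])
    moreover have "finite_in_x D f"
    proof -
      obtain K where K: "compact K" "K \<subseteq> D" "\<And>x is. x \<notin> K \<Longrightarrow> length is = m \<Longrightarrow> w x is = 0"
        using w unfolding admissible_tensor_field_def by blast
      have "f (x, \<xi>) = 0" if "x \<notin> K" "norm \<xi> = 1" for x \<xi>
        using K(3) that by (simp add: feq tensor_pairing_def)
      then show ?thesis
        using K(1,2) unfolding finite_in_x_def by (intro exI[of _ K]) simp
    qed
    ultimately have "solves_L_equation D \<alpha> (Suc k) (ART \<alpha> k f) f"
      using \<alpha> by (intro solves_L_equation_ART)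
    then show ?thesis
      using feq by (simp add: solves_L_equation_def sphere_bundle_def)
  qed
  ultimately show ?thesis by blast
qed

end
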